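(* Let $n>1$. Let $J^\alpha f=K_\alpha\ast f$ be a family of operators defined by convolution, where $K_\alpha,f:(0,\infty)^n\rightarrow\mathbb{R}$, $\alpha\in(0,\infty)^n$, $f\in\mathcal{L}$, and $K_\alpha\in\mathcal{L}$ for all $\alpha\in(0,\infty)^n$. Suppose: - Identity: $K_\alpha(x)=x_1^{\alpha_1-1}\cdots x_n^{\alpha_n-1}/(\Gamma(\alpha_1)\cdots\Gamma(\alpha_n))$ for all $x\in(0,\infty)^n$, for $n$ tuples $\alpha=\alpha^{(j)}\in(0,\infty)^n$, $j=1,\ldots,n$, that are linearly independent. That is, the kernel $K_\alpha$ coincides with the Riemann-Liouville kernel on $(0,\infty)^n$ (i.e. $J^\alpha=I^\alpha$) at $n$ fractional-order vectors that are linearly independent; - Index law: $J^{\alpha+\beta}=J^\alpha\circ J^\beta$ on $\mathcal{L}$ for all $\alpha,\beta\in(0,\infty)^n$; - Continuity: for all $x\in(0,\infty)^n$, the map $\alpha\mapsto\widehat{K}_\alpha(x)$ from $(0,\infty)^n$ to $\mathbb{R}$ is continuous at one point. (This condition is equivalent to: for all $f\in\mathcal{L}$ and $x\in(0,\infty)^n$, the map $\alpha\mapsto\widehat{J^\alpha f}(x)$ from $(0,\infty)^n$ to $\mathbb{R}$ is continuous at one point.) Then $J^\alpha=I^\alpha$ is the multidimensional Riemann-Liouville integral on $\mathcal{L}$, for all $\alpha\in(0,\infty)^n$.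
   Context: $\mathcal{L}$ is the set of Laplace transformable functions $f:(0,\infty)^n\to\mathbb{R}$, i.e. those for which $\widehat{f}(x):=\int_{(0,\infty)^n}f(s)\mathrm{e}^{-s\cdot x}\,\mathrm{d}s$ is well-defined (as a Lebesgue integral) for all $x\in(0,\infty)^n$; in particular $f\in\mathrm{L}^1(0,T)$ for every box $(0,T)=(0,T_1)\times\cdots\times(0,T_n)$ with $T\in(0,\infty)^n$. The hat denotes this Laplace transform. Convolution is $(K\ast f)(t)=\int_{[0,t_1]\times\cdots\times[0,t_n]}K(t-s)f(s)\,\mathrm{d}s$. For $\alpha\in(0,\infty)^n$, $I^\alpha f=g_\alpha\ast f$ with $g_\alpha(t)=\prod_{i=1}^nt_i^{\alpha_i-1}/\Gamma(\alpha_i)$ is the Riemann-Liouville integral with left origin $(0,\ldots,0)$. Functions are identified when equal almost everywhere. *)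

theory Defs
  imports "HOL-Analysis.Analysis"
begin

text \<open>
  A function \<open>(0,\<infinity>)\<^sup>n \<Rightarrow> \<real>\<close> is represented by a total function on \<open>real ^ 'n\<close>, with \<open>n = CARD('n)\<close>;
  its values outside the open orthant never matter. Measurability and integrability refer to
  Lebesgue measure on \<open>real ^ 'n\<close>.
\<close>

definition pos_orthant :: "(real ^ 'n) set" where
  "pos_orthant = {x. \<forall>i. 0 < x $ i}"

definition ae_eq :: "(real ^ 'n \<Rightarrow> real) \<Rightarrow> (real ^ 'n \<Rightarrow> real) \<Rightarrow> bool" where
  "ae_eq f g \<longleftrightarrow> (AE t in lebesgue. t \<in> pos_orthant \<longrightarrow> f t = g t)"

definition laplace_transformable :: "(real ^ 'n \<Rightarrow> real) set" where
  "laplace_transformable =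
    {f. \<forall>x\<in>pos_orthant. set_integrable lebesgue pos_orthant (\<lambda>s. f s * exp (- (s \<bullet> x)))}"

definition laplace_transform :: "(real ^ 'n \<Rightarrow> real) \<Rightarrow> real ^ 'n \<Rightarrow> real" where
  "laplace_transform f x = (LINT s:pos_orthant|lebesgue. f s * exp (- (s \<bullet> x)))"

text \<open>
  The boundary of \<open>cbox 0 t\<close>, where the integrand involves values outside the open orthant, is a
  null set. Where the integral does not exist (for transformable \<open>K\<close> and \<open>f\<close>, only on a null set
  of \<open>t\<close>) the value is 0; equalities between convolutions are therefore stated with \<open>ae_eq\<close>.
\<close>

definition convolution ::
    "(real ^ 'n \<Rightarrow> real) \<Rightarrow> (real ^ 'n \<Rightarrow> real) \<Rightarrow> real ^ 'n \<Rightarrow> real" where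
  "convolution K f t = (LINT s:cbox 0 t|lebesgue. K (t - s) * f s)"

definition RL_kernel :: "real ^ 'n \<Rightarrow> real ^ 'n \<Rightarrow> real" where
  "RL_kernel \<alpha> t = (\<Prod>i\<in>UNIV. t $ i powr (\<alpha> $ i - 1) / Gamma (\<alpha> $ i))"

definition RL_integral :: "real ^ 'n \<Rightarrow> (real ^ 'n \<Rightarrow> real) \<Rightarrow> real ^ 'n \<Rightarrow> real" where
  "RL_integral \<alpha> f = convolution (RL_kernel \<alpha>) f"

definition conv_op ::
    "(real ^ 'n \<Rightarrow> real ^ 'n \<Rightarrow> real) \<Rightarrow> real ^ 'n \<Rightarrow> (real ^ 'n \<Rightarrow> real) \<Rightarrow> real ^ 'n \<Rightarrow> real" where
  "conv_op K \<alpha> f = convolution (K \<alpha>) f"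

end

theory Submission
  imports Defs
begin

text \<open>
  The Laplace transform turns convolution into multiplication, so for each fixed \<open>x\<close> the index law
  makes \<open>\<phi> \<alpha> = laplace_transform (K \<alpha>) x\<close> multiplicative in \<open>\<alpha>\<close>. It takes positive values at
  the \<open>a j\<close> and therefore nowhere vanishes, and being a square it is positive. The logarithm of
  \<open>\<phi> \<alpha> / (\<Prod>i. x\<^sub>i powr - \<alpha>\<^sub>i)\<close> is additive on the orthant and extends to an additive function on
  the whole space that is bounded near the origin and vanishes on a basis; such a function is zero.
  Hence \<open>K \<alpha>\<close> and the Riemann--Liouville kernel have the same Laplace transform, and the Laplace
  transform is injective.
\<close>

section \<open>The Laplace transform of a convolution\<close>

lemma lborel_distr_minus_left: "distr lborel borel (\<lambda>s. t - s) = (lborel :: 'a::euclidean_space measure)"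
  using lborel_affine[of "-1" t] by (simp add: density_1)

lemma lborel_distr_minus_right: "distr lborel borel (\<lambda>s. s - t) = (lborel :: 'a::euclidean_space measure)"
  using lborel_affine[of 1 "-t"] by (simp add: density_1)

text \<open>Lebesgue measure is complete, so agreement almost everywhere with a Borel function
  already makes \<open>f\<close> measurable. This carries integrals from \<open>lebesgue\<close> to
  \<open>lborel\<close>, where Fubini's theorem is applied.\<close>

lemma lebesgue_AE_eq_lborel:
  fixes f g :: "'a::euclidean_space \<Rightarrow> real"
  assumes g [measurable]: "g \<in> borel_measurable borel" and eq: "AE x in lborel. f x = g x"
  shows "f \<in> borel_measurable lebesgue"
    and "integrable lebesgue f \<longleftrightarrow> integrable lborel g"
    and "integral\<^sup>L lebesgue f = integral\<^sup>L lborel g"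
proof -
  have gl: "g \<in> borel_measurable lebesgue"
    by (rule measurable_completion) simp
  have eq': "AE x in lebesgue. f x = g x"
    using eq by (rule AE_completion)
  show f: "f \<in> borel_measurable lebesgue"
  proof (rule measurableI)
    fix A :: "real set" assume A: "A \<in> sets borel"
    show "f -` A \<inter> space lebesgue \<in> sets lebesgue"
    proof (rule completion.in_sets_AE)
      show "AE x in lebesgue. x \<in> g -` A \<inter> space lebesgue \<longleftrightarrow> x \<in> f -` A \<inter> space lebesgue"
        using eq' by eventually_elim auto
      show "g -` A \<inter> space lebesgue \<in> sets lebesgue"
        using gl A by (rule measurable_sets)
    qed auto
  qed auto
  have "integrable lebesgue f \<longleftrightarrow> integrable lebesgue g"
    by (rule integrable_cong_AE) (use f gl eq' in auto)
  also have "\<dots> \<longleftrightarrow> integrable lborel g"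
    by (rule integrable_completion) simp
  finally show "integrable lebesgue f \<longleftrightarrow> integrable lborel g" .
  have "integral\<^sup>L lebesgue f = integral\<^sup>L lebesgue g"
    by (rule integral_cong_AE) (use f gl eq' in auto)
  also have "\<dots> = integral\<^sup>L lborel g"
    by (rule integral_completion) simp
  finally show "integral\<^sup>L lebesgue f = integral\<^sup>L lborel g" .
qed

lemma open_pos_orthant: "open (pos_orthant :: (real ^ 'n) set)"
proof -
  have "pos_orthant = (\<Inter>i\<in>UNIV. {x :: real ^ 'n. 0 < x $ i})"
    by (auto simp: pos_orthant_def)
  also have "open \<dots>"
    by (intro open_INT ballI open_Collect_less continuous_intros) auto
  finally show ?thesis .
qed

lemma pos_orthant_borel [measurable]: "(pos_orthant :: (real ^ 'n) set) \<in> sets borel"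
  using open_pos_orthant by (rule borel_open)

lemma pos_orthant_add: "x \<in> pos_orthant \<Longrightarrow> y \<in> pos_orthant \<Longrightarrow> x + y \<in> pos_orthant"
  by (auto simp: pos_orthant_def add_pos_pos)

lemma pos_orthant_scaleR: "c > 0 \<Longrightarrow> x \<in> pos_orthant \<Longrightarrow> c *\<^sub>R x \<in> pos_orthant"
  by (auto simp: pos_orthant_def)

lemma one_in_pos_orthant: "1 \<in> pos_orthant"
  by (auto simp: pos_orthant_def)

text \<open>
  Fubini's theorem for \<open>K (t - s) * f s\<close> needs joint measurability in \<open>(s, t)\<close>, which
  Lebesgue measurable functions do not give; hence the passage to Borel representatives.
\<close>

definition borel_rep :: "(real ^ 'n \<Rightarrow> real) \<Rightarrow> (real ^ 'n \<Rightarrow> real) \<Rightarrow> bool" where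
  "borel_rep f g \<longleftrightarrow> g \<in> borel_measurable borel \<and> (\<forall>s. s \<notin> pos_orthant \<longrightarrow> g s = 0) \<and>
     (AE s in lborel. s \<in> pos_orthant \<longrightarrow> f s = g s) \<and>
     (\<forall>x\<in>pos_orthant. integrable lborel (\<lambda>s. g s * exp (- (s \<bullet> x))))"

lemma borel_repD:
  assumes "borel_rep f g"
  shows "g \<in> borel_measurable borel" "s \<notin> pos_orthant \<Longrightarrow> g s = 0"
    "AE s in lborel. s \<in> pos_orthant \<longrightarrow> f s = g s"
    "x \<in> pos_orthant \<Longrightarrow> integrable lborel (\<lambda>s. g s * exp (- (s \<bullet> x)))"
  using assms by (auto simp: borel_rep_def)

lemma borel_rep_laplace:
  assumes "borel_rep f g"
  shows "f \<in> laplace_transformable"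
    and "laplace_transform f x = (\<integral>s. g s * exp (- (s \<bullet> x)) \<partial>lborel)"
proof -
  note [measurable] = borel_repD(1)[OF assms]
  have *: "AE s in lborel. indicator pos_orthant s *\<^sub>R (f s * exp (- (s \<bullet> x))) = g s * exp (- (s \<bullet> x))" for x
    using borel_repD(3)[OF assms]
    by eventually_elim (auto simp: indicator_def borel_repD(2)[OF assms])
  note ** = lebesgue_AE_eq_lborel(2,3)[OF _ *]
  show "f \<in> laplace_transformable"
    unfolding laplace_transformable_def set_integrable_def
    using **(1) borel_repD(4)[OF assms] by simp
  show "laplace_transform f x = (\<integral>s. g s * exp (- (s \<bullet> x)) \<partial>lborel)"
    unfolding laplace_transform_def set_lebesgue_integral_def using **(2)[of x] by simp
qed

lemma borel_rep_exists:
  assumes "f \<in> laplace_transformable"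
  obtains g where "borel_rep f g"
proof -
  have int: "integrable lebesgue (\<lambda>s. indicator pos_orthant s *\<^sub>R (f s * exp (- (s \<bullet> x))))"
    if "x \<in> pos_orthant" for x
    using assms that by (auto simp: laplace_transformable_def set_integrable_def)
  \<comment> \<open>A single weight yields the representative:
    \<open>exp (- (s \<bullet> 1))\<close> is nowhere zero and can be divided out of
    \<open>h\<close> again. Integrability at the other \<open>x\<close> is then inherited from
    \<open>f\<close>.\<close>
  obtain h where h [measurable]: "h \<in> borel_measurable borel" and
    eq: "AE s in lborel. indicator pos_orthant s *\<^sub>R (f s * exp (- (s \<bullet> 1))) = h s"
    using completion_ex_borel_measurable_real[OF borel_measurable_integrable[OF int[OF one_in_pos_orthant]]]
    by auto
  define g where "g s = indicator pos_orthant s * (h s * exp (s \<bullet> 1))" for s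
  have g [measurable]: "g \<in> borel_measurable borel"
    unfolding g_def by measurable
  have fg: "AE s in lborel. s \<in> pos_orthant \<longrightarrow> f s = g s"
    using eq by eventually_elim (auto simp: g_def exp_minus field_simps)
  have "integrable lborel (\<lambda>s. g s * exp (- (s \<bullet> x)))" if "x \<in> pos_orthant" for x
  proof (subst lebesgue_AE_eq_lborel(2)[symmetric])
    show "AE s in lborel. indicator pos_orthant s *\<^sub>R (f s * exp (- (s \<bullet> x))) = g s * exp (- (s \<bullet> x))"
      using fg by eventually_elim (auto simp: g_def indicator_def)
  qed (use int that in auto)
  then show ?thesis
    using fg g by (intro that[of g]) (auto simp: borel_rep_def g_def)
qed

lemma borel_rep_cong:
  assumes "borel_rep f g" "ae_eq f f'"
  shows "borel_rep f' g"
proof -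
  have "AE s in lborel. s \<in> pos_orthant \<longrightarrow> f s = f' s"
    using assms(2) by (simp add: ae_eq_def AE_completion_iff)
  with borel_repD(3)[OF assms(1)] have "AE s in lborel. s \<in> pos_orthant \<longrightarrow> f' s = g s"
    by eventually_elim auto
  with assms(1) show ?thesis by (auto simp: borel_rep_def)
qed

lemma borel_rep_ae_eq:
  assumes "borel_rep f g" "borel_rep f' g'" "AE s in lborel. g s = g' s"
  shows "ae_eq f f'"
proof -
  have "AE s in lborel. s \<in> pos_orthant \<longrightarrow> f s = f' s"
    using borel_repD(3)[OF assms(1)] borel_repD(3)[OF assms(2)] assms(3) by eventually_elim auto
  then show ?thesis by (simp add: ae_eq_def AE_completion_iff)
qed

lemma laplace_transform_cong:
  assumes "f \<in> laplace_transformable" "ae_eq f f'"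
  shows "laplace_transform f x = laplace_transform f' x"
  by (metis assms borel_rep_cong borel_rep_exists borel_rep_laplace(2))

text \<open>The integrand on the right vanishes unless \<open>s\<close> and \<open>t - s\<close>
  both lie in the orthant, which confines \<open>s\<close> to the open box between \<open>0\<close>
  and \<open>t\<close>. All exceptional null sets are in the variable \<open>s\<close>, so equality
  holds at every \<open>t\<close>.\<close>

lemma convolution_borel_rep:
  assumes "borel_rep K k" "borel_rep f g"
  shows "convolution K f t = (\<integral>s. k (t - s) * g s \<partial>lborel)"
proof -
  note [measurable] = borel_repD(1)[OF assms(1)] borel_repD(1)[OF assms(2)]
  \<comment> \<open>The reflection \<open>s \<mapsto> t - s\<close> preserves Lebesgue measure, so
    the null set of the orthant where \<open>K\<close> and \<open>k\<close> differ pulls back to a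
    null set.\<close>
  have "AE s in distr lborel borel (\<lambda>s. t - s). s \<in> pos_orthant \<longrightarrow> K s = k s"
    unfolding lborel_distr_minus_left by (rule borel_repD(3)[OF assms(1)])
  then have "AE s in lborel. t - s \<in> pos_orthant \<longrightarrow> K (t - s) = k (t - s)"
    by (rule AE_distrD[rotated]) simp
  \<comment> \<open>Away from the boundary of the box, \<open>s\<close> or \<open>t - s\<close>
    being outside the orthant forces \<open>s\<close> out of \<open>cbox 0 t\<close>, so that both
    integrands are zero.\<close>
  moreover have "AE s in lborel. s \<notin> cbox 0 t - box 0 t"
    by (rule AE_not_in[OF null_sets_cbox_Diff_box])
  ultimately have "AE s in lborel. indicator (cbox 0 t) s *\<^sub>R (K (t - s) * f s) = k (t - s) * g s"
    using borel_repD(3)[OF assms(2)]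
  proof eventually_elim
    case (elim s)
    consider "s \<in> pos_orthant" "t - s \<in> pos_orthant" | "s \<notin> pos_orthant" | "t - s \<notin> pos_orthant" by blast
    then show ?case
    proof cases
      case 1
      then have "s \<in> cbox 0 t"
        by (auto simp: pos_orthant_def mem_box_cart less_imp_le)
      with 1 elim show ?thesis by simp
    next
      case 2
      then have "s \<notin> box 0 t" by (auto simp: pos_orthant_def mem_box_cart)
      with 2 elim borel_repD(2)[OF assms(2) 2] show ?thesis by auto
    next
      case 3
      then have "s \<notin> box 0 t" by (auto simp: pos_orthant_def mem_box_cart)
      with 3 elim borel_repD(2)[OF assms(1) 3] show ?thesis by auto
    qed
  qed
  from lebesgue_AE_eq_lborel(3)[OF _ this] show ?thesis
    by (simp add: convolution_def set_lebesgue_integral_def)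
qed

text \<open>Kernels that agree almost everywhere share a representative, and the value of the
  convolution at each single \<open>t\<close> depends on representatives only; hence an equality of
  functions rather than \<open>ae_eq\<close>.\<close>

lemma convolution_cong:
  assumes "K \<in> laplace_transformable" "f \<in> laplace_transformable" "ae_eq K K'"
  shows "convolution K f = convolution K' f"
proof
  fix t
  obtain k where k: "borel_rep K k" using assms(1) by (rule borel_rep_exists)
  obtain g where g: "borel_rep f g" using assms(2) by (rule borel_rep_exists)
  show "convolution K f t = convolution K' f t"
    using convolution_borel_rep[OF k g] convolution_borel_rep[OF borel_rep_cong[OF k assms(3)] g] by simp
qed

text \<open>Fubini's theorem, integrating over \<open>t\<close> first: by translation invariance the
  inner integral is a constant times \<open>G s\<close>. The same computation with norms gives
  integrability on the product space.\<close>

lemma integral_convolution_lborel: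
  fixes F G :: "'a::euclidean_space \<Rightarrow> real"
  assumes F: "integrable lborel F" and G: "integrable lborel G"
  shows "integrable lborel (\<lambda>t. \<integral>s. F (t - s) * G s \<partial>lborel)"
    and "(\<integral>t. (\<integral>s. F (t - s) * G s \<partial>lborel) \<partial>lborel) = integral\<^sup>L lborel F * integral\<^sup>L lborel G"
proof -
  have [measurable]: "F \<in> borel_measurable borel" "G \<in> borel_measurable borel"
    using F G by (auto dest: borel_measurable_integrable)
  have shift: "integrable lborel (\<lambda>t. H (t - s))" "(\<integral>t. H (t - s) \<partial>lborel) = integral\<^sup>L lborel H"
    if "integrable lborel H" for H :: "'a \<Rightarrow> real" and s
  proof -
    have [measurable]: "H \<in> borel_measurable borel"
      using that by (auto dest: borel_measurable_integrable)
    show "integrable lborel (\<lambda>t. H (t - s))"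
      using integrable_distr_eq[of "\<lambda>t. t - s" lborel borel H] that by (simp add: lborel_distr_minus_right)
    show "(\<integral>t. H (t - s) \<partial>lborel) = integral\<^sup>L lborel H"
      using integral_distr[of "\<lambda>t. t - s" lborel borel H] by (simp add: lborel_distr_minus_right)
  qed
  let ?f = "\<lambda>(s, t). F (t - s) * G s"
  have int: "integrable (lborel \<Otimes>\<^sub>M lborel) ?f"
  proof (rule lborel_pair.Fubini_integrable)
    show "?f \<in> borel_measurable (lborel \<Otimes>\<^sub>M lborel)" by measurable
    have "(\<lambda>s. \<integral>t. norm (?f (s, t)) \<partial>lborel) = (\<lambda>s. (\<integral>t. norm (F t) \<partial>lborel) * norm (G s))"
      using shift(2)[OF integrable_norm[OF F]] by (simp add: abs_mult)
    then show "integrable lborel (\<lambda>s. \<integral>t. norm (?f (s, t)) \<partial>lborel)"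
      using G by simp
    show "AE s in lborel. integrable lborel (\<lambda>t. ?f (s, t))"
      using shift(1)[OF F] by simp
  qed
  show "integrable lborel (\<lambda>t. \<integral>s. F (t - s) * G s \<partial>lborel)"
    using lborel_pair.integrable_snd[OF int] by simp
  have "(\<integral>t. (\<integral>s. F (t - s) * G s \<partial>lborel) \<partial>lborel) = (\<integral>s. (\<integral>t. F (t - s) * G s \<partial>lborel) \<partial>lborel)"
    using lborel_pair.Fubini_integral[OF int] by simp
  also have "\<dots> = (\<integral>s. integral\<^sup>L lborel F * G s \<partial>lborel)"
    using shift(2)[OF F] by simp
  finally show "(\<integral>t. (\<integral>s. F (t - s) * G s \<partial>lborel) \<partial>lborel) = integral\<^sup>L lborel F * integral\<^sup>L lborel G"
    by simp
qed

lemma laplace_convolution: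
  fixes K f :: "real ^ 'n \<Rightarrow> real"
  assumes "K \<in> laplace_transformable" "f \<in> laplace_transformable"
  shows "convolution K f \<in> laplace_transformable"
    and "x \<in> pos_orthant \<Longrightarrow>
      laplace_transform (convolution K f) x = laplace_transform K x * laplace_transform f x"
proof -
  obtain k where k: "borel_rep K k" using assms(1) by (rule borel_rep_exists)
  obtain g where g: "borel_rep f g" using assms(2) by (rule borel_rep_exists)
  note [measurable] = borel_repD(1)[OF k] borel_repD(1)[OF g]
  define c where "c t = (\<integral>s. k (t - s) * g s \<partial>lborel)" for t
  have [measurable]: "c \<in> borel_measurable borel"
    unfolding c_def by measurable
  \<comment> \<open>The weight at \<open>t\<close> is the product of the weights at
    \<open>t - s\<close> and at \<open>s\<close>, so the weighted convolution is the convolution of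
    the weighted functions, which are integrable for \<open>x\<close> in the orthant.\<close>
  have exp_c: "c t * exp (- (t \<bullet> x)) =
      (\<integral>s. (k (t - s) * exp (- ((t - s) \<bullet> x))) * (g s * exp (- (s \<bullet> x))) \<partial>lborel)" for t x
    unfolding c_def by (subst integral_mult_left_zero[symmetric], rule Bochner_Integration.integral_cong)
      (auto simp: inner_diff_left exp_diff exp_minus field_simps)
  have c: "borel_rep (convolution K f) c"
    unfolding borel_rep_def
  proof (intro conjI ballI allI impI)
    fix t :: "real ^ 'n" assume "t \<notin> pos_orthant"
    then obtain i where i: "t $ i \<le> 0" by (auto simp: pos_orthant_def not_less)
    have "k (t - s) * g s = 0" for s
    proof (cases "s \<in> pos_orthant")
      case True
      with i have "t $ i - s $ i \<le> 0"
        unfolding pos_orthant_def by (auto intro: order.trans less_imp_le)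
      then have "t - s \<notin> pos_orthant"
        unfolding pos_orthant_def by (auto simp: not_less intro!: exI[of _ i])
      then show ?thesis by (simp add: borel_repD(2)[OF k])
    qed (simp add: borel_repD(2)[OF g])
    then have "(\<lambda>s. k (t - s) * g s) = (\<lambda>_. 0)" by blast
    then show "c t = 0" by (simp only: c_def) simp
  next
    fix x :: "real ^ 'n" assume "x \<in> pos_orthant"
    then show "integrable lborel (\<lambda>s. c s * exp (- (s \<bullet> x)))"
      unfolding exp_c by (intro integral_convolution_lborel(1) borel_repD(4)[OF k] borel_repD(4)[OF g])
  qed (simp_all add: convolution_borel_rep[OF k g] c_def)
  show "convolution K f \<in> laplace_transformable"
    using c by (rule borel_rep_laplace)
  show "laplace_transform (convolution K f) x = laplace_transform K x * laplace_transform f x"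
    if "x \<in> pos_orthant"
    unfolding borel_rep_laplace(2)[OF c] borel_rep_laplace(2)[OF k] borel_rep_laplace(2)[OF g] exp_c
    using that by (intro integral_convolution_lborel(2) borel_repD(4)[OF k] borel_repD(4)[OF g])
qed

section \<open>Injectivity of the Laplace transform\<close>

text \<open>Dynkin's argument for the signed measure with density \<open>h\<close>, pushed forward
  along \<open>e\<close>: closed sets are an intersection-stable generator of the Borel sets, and
  the sets to which the measure gives the value zero are stable under complements and countable
  disjoint unions.\<close>

lemma integral_indicator_zero_sigma:
  fixes h :: "'a \<Rightarrow> real" and e :: "'a \<Rightarrow> 'b::topological_space"
  assumes h: "integrable M h" and e [measurable]: "e \<in> borel_measurable M"
    and closed: "\<And>C. closed C \<Longrightarrow> (\<integral>s. h s * indicator C (e s) \<partial>M) = 0"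
    and B: "B \<in> sets borel"
  shows "(\<integral>s. h s * indicator B (e s) \<partial>M) = 0"
proof -
  have [measurable]: "h \<in> borel_measurable M" using h by auto
  have int: "integrable M (\<lambda>s. h s * indicator A (e s))" if [measurable]: "A \<in> sets borel" for A
    by (rule Bochner_Integration.integrable_bound[OF h]) (auto simp: indicator_def)
  have "Int_stable {C :: 'b set. closed C}"
    by (auto simp: Int_stable_def)
  moreover have "{C :: 'b set. closed C} \<subseteq> Pow UNIV"
    by auto
  moreover have "B \<in> sigma_sets UNIV {C. closed C}"
    using B by (simp add: borel_eq_closed)
  ultimately show ?thesis
  proof (induction rule: sigma_sets_induct_disjoint)
    case (basic A)
    then show ?case by (simp add: closed)
  next
    case empty
    then show ?case by simp
  next
    case (compl A)
    then have [measurable]: "A \<in> sets borel" by (simp add: borel_eq_closed)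
    \<comment> \<open>\<open>UNIV\<close> is itself closed, so the total integral of
      \<open>h\<close> is zero and complements inherit the value zero.\<close>
    have "(\<integral>s. h s * indicator (UNIV - A) (e s) \<partial>M)
        = (\<integral>s. h s * indicator UNIV (e s) - h s * indicator A (e s) \<partial>M)"
      by (rule Bochner_Integration.integral_cong) (auto simp: indicator_def)
    also have "\<dots> = 0"
      using closed[of UNIV] compl int[of A] int[of UNIV]
      by (subst Bochner_Integration.integral_diff) auto
    finally show ?case .
  next
    case (union A)
    then have [measurable]: "\<And>i. A i \<in> sets borel" by (auto simp: borel_eq_closed)
    \<comment> \<open>Dominated convergence with bound \<open>\<bar>h s\<bar>\<close> passes from
      partial unions to the countable union; by disjointness each partial integral is a finite sum
      of zeros.\<close>
    have "(\<lambda>i. \<integral>s. h s * indicator (\<Union>j<i. A j) (e s) \<partial>M)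
        \<longlonglongrightarrow> (\<integral>s. h s * indicator (\<Union>i. A i) (e s) \<partial>M)"
    proof (rule integral_dominated_convergence)
      show "integrable M (\<lambda>s. \<bar>h s\<bar>)" using h by simp
      have "(\<lambda>i. indicator (\<Union>j<i. A j) y :: real) \<longlonglongrightarrow> indicator (\<Union>i. A i) y" for y
        by (rule LIMSEQ_indicator_UN)
      then show "AE s in M. (\<lambda>i. h s * indicator (\<Union>j<i. A j) (e s)) \<longlonglongrightarrow> h s * indicator (\<Union>i. A i) (e s)"
        by (intro AE_I2 tendsto_mult tendsto_const)
    qed (auto simp: indicator_def)
    moreover have "(\<integral>s. h s * indicator (\<Union>j<i. A j) (e s) \<partial>M) = 0" for i
    proof -
      have "indicator (\<Union>j<i. A j) y = (\<Sum>j<i. indicator (A j) y :: real)" for y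
        by (rule indicator_UN_disjoint)
           (use union.hyps(1) in \<open>auto simp: disjoint_family_on_def\<close>)
      then have "(\<integral>s. h s * indicator (\<Union>j<i. A j) (e s) \<partial>M)
          = (\<integral>s. (\<Sum>j<i. h s * indicator (A j) (e s)) \<partial>M)"
        by (simp only: sum_distrib_left)
      also have "\<dots> = (\<Sum>j<i. \<integral>s. h s * indicator (A j) (e s) \<partial>M)"
        using int by (intro Bochner_Integration.integral_sum) auto
      also have "\<dots> = 0"
        using union.IH by simp
      finally show ?thesis .
    qed
    ultimately show ?case
      by (simp add: LIMSEQ_const_iff)
  qed
qed

text \<open>
  Under \<open>y = exp (- s)\<close> (componentwise) the exponential moments become the monomial moments on the
  unit cube, so that the Stone--Weierstrass theorem applies.
\<close>

lemma exp_moments_zero_imp_AE_zero: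
  fixes h :: "real ^ 'n \<Rightarrow> real"
  assumes h: "integrable lborel h" and supp: "\<And>s. s \<notin> pos_orthant \<Longrightarrow> h s = 0"
    and moments: "\<And>k :: 'n \<Rightarrow> nat. (\<integral>s. h s * (\<Prod>i\<in>UNIV. exp (- (s $ i)) ^ k i) \<partial>lborel) = 0"
  shows "AE s in lborel. h s = 0"
proof -
  define e :: "real ^ 'n \<Rightarrow> real ^ 'n" where "e s = (\<chi> i. exp (- (s $ i)))" for s
  define E :: "('n \<Rightarrow> nat) \<Rightarrow> real ^ 'n \<Rightarrow> real" where "E k s = (\<Prod>i\<in>UNIV. e s $ i ^ k i)" for k s
  have [measurable]: "h \<in> borel_measurable borel"
    using borel_measurable_integrable[OF h] by simp
  have "continuous_on UNIV e"
    unfolding e_def by (intro continuous_intros)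
  then have [measurable]: "e \<in> borel_measurable borel"
    by (rule borel_measurable_continuous_onI)
  have e_cube: "e s \<in> cbox 0 1" if "s \<in> pos_orthant" for s
    using that by (auto simp: e_def mem_box_cart pos_orthant_def less_imp_le)
  have E_meas [measurable]: "E k \<in> borel_measurable borel" for k
    unfolding E_def e_def by (intro borel_measurable_continuous_onI continuous_intros)
  \<comment> \<open>\<open>V m\<close> demands vanishing against \<open>m\<close> times every
    monomial: multiplying by a coordinate raises an exponent, and the quantifier over
    \<open>k\<close> absorbs this. The form with \<open>has_bochner_integral\<close> carries
    integrability through the induction.\<close>
  define V where "V m \<longleftrightarrow> (\<forall>k. has_bochner_integral lborel (\<lambda>s. h s * E k s * m (e s)) 0)"
    for m :: "real ^ 'n \<Rightarrow> real"
  have V_one: "V (\<lambda>_. 1)"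
    unfolding V_def has_bochner_integral_iff
  proof (intro allI conjI)
    fix k
    \<comment> \<open>Where \<open>h\<close> can be nonzero, \<open>e s\<close> lies in the unit
      cube, and monomials there have values between 0 and 1.\<close>
    have "\<bar>h s * E k s\<bar> \<le> \<bar>h s\<bar>" for s
    proof (cases "s \<in> pos_orthant")
      case True
      then have "0 \<le> E k s" "E k s \<le> 1"
        using e_cube[OF True] unfolding E_def
        by (auto intro!: prod_nonneg prod_le_1 power_le_one simp: mem_box_cart)
      then show ?thesis by (simp add: abs_mult mult_left_le)
    qed (simp add: supp)
    then show "integrable lborel (\<lambda>s. h s * E k s * 1)"
      by (intro Bochner_Integration.integrable_bound[OF h]) auto
    show "(\<integral>s. h s * E k s * 1 \<partial>lborel) = 0"
      using moments[of k] by (simp add: E_def e_def)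
  qed
  \<comment> \<open>The induction runs with arbitrary \<open>m\<close>, so that a product is handled
    by multiplying first by \<open>p\<close> and then by \<open>q\<close>.\<close>
  have V_poly: "V m \<Longrightarrow> V (\<lambda>y. m y * p y)" if "real_polynomial_function p" for p m
    using that
  proof (induction arbitrary: m rule: real_polynomial_function.induct)
    case (linear p)
    have p_eq: "p y = (\<Sum>i\<in>UNIV. p (axis i 1) * y $ i)" for y
    proof -
      have "p y = p (\<Sum>i\<in>UNIV. y $ i *\<^sub>R axis i 1)"
        by (simp add: basis_expansion flip: scalar_mult_eq_scaleR)
      also have "\<dots> = (\<Sum>i\<in>UNIV. p (axis i 1) * y $ i)"
        using bounded_linear.linear[OF linear(1)]
        by (simp add: linear_sum linear_cmul mult.commute)
      finally show ?thesis .
    qed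
    show ?case
      unfolding V_def
    proof
      fix k
      have E_suc: "E (k(i := Suc (k i))) s = E k s * e s $ i" for i s
      proof -
        have "E (k(i := Suc (k i))) s = (\<Prod>j\<in>UNIV. e s $ j ^ k j * (if j = i then e s $ j else 1))"
          unfolding E_def by (rule prod.cong) auto
        then show ?thesis by (simp add: prod.distrib E_def)
      qed
      have "has_bochner_integral lborel
          (\<lambda>s. \<Sum>i\<in>UNIV. p (axis i 1) * (h s * E (k(i := Suc (k i))) s * m (e s))) (\<Sum>i\<in>(UNIV::'n set). p (axis i 1) * 0)"
        using linear(2) unfolding V_def
        by (intro has_bochner_integral_sum has_bochner_integral_mult_right) auto
      then show "has_bochner_integral lborel (\<lambda>s. h s * E k s * (m (e s) * p (e s))) 0"
        unfolding E_suc p_eq[of "e _"] by (simp add: sum_distrib_left mult_ac)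
    qed
  next
    case (const c)
    have "has_bochner_integral lborel (\<lambda>s. h s * E k s * m (e s) * c) (0 * c)" for k
      using const unfolding V_def by (intro has_bochner_integral_mult_left) auto
    then show ?case by (simp add: V_def mult_ac)
  next
    case (add p q)
    have "has_bochner_integral lborel
        (\<lambda>s. h s * E k s * (m (e s) * p (e s)) + h s * E k s * (m (e s) * q (e s))) (0 + 0)" for k
      using add.IH[OF add.prems] unfolding V_def by (intro has_bochner_integral_add) auto
    then show ?case by (simp add: V_def algebra_simps)
  next
    case (mult p q)
    then show ?case by (simp add: mult.assoc[symmetric])
  qed
  \<comment> \<open>The case \<open>m = 1\<close> with all exponents zero, where \<open>E\<close> is
    constantly 1.\<close>
  have poly: "integrable lborel (\<lambda>s. h s * p (e s))" "(\<integral>s. h s * p (e s) \<partial>lborel) = 0"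
    if "real_polynomial_function p" for p
    using V_poly[OF that V_one] unfolding V_def
    by (auto simp: has_bochner_integral_iff E_def dest!: spec[of _ "\<lambda>_. 0"])
  have cont: "(\<integral>s. h s * \<phi> (e s) \<partial>lborel) = 0" if \<phi>: "continuous_on UNIV \<phi>" for \<phi>
  proof -
    have [measurable]: "\<phi> \<in> borel_measurable borel"
      using \<phi> by (rule borel_measurable_continuous_onI)
    have bound: "\<bar>\<integral>s. h s * \<phi> (e s) \<partial>lborel\<bar> \<le> \<epsilon> * (\<integral>s. \<bar>h s\<bar> \<partial>lborel)" if "\<epsilon> > 0" for \<epsilon>
    proof -
      \<comment> \<open>The approximation is on the unit cube, which contains \<open>e s\<close> for
        every \<open>s\<close> in the orthant; for other \<open>s\<close> the error is multiplied by
        \<open>h s = 0\<close>.\<close>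
      obtain p where p: "real_polynomial_function p" "\<And>y. y \<in> cbox 0 1 \<Longrightarrow> \<bar>\<phi> y - p y\<bar> < \<epsilon>"
        using Stone_Weierstrass_real_polynomial_function[OF compact_cbox continuous_on_subset[OF \<phi>] \<open>\<epsilon> > 0\<close>]
        by blast
      have [measurable]: "p \<in> borel_measurable borel"
        using p(1) by (intro borel_measurable_continuous_onI continuous_on_polymonial_function)
          (simp add: real_polynomial_function_eq)
      have le: "\<bar>h s * (\<phi> (e s) - p (e s))\<bar> \<le> \<epsilon> * \<bar>h s\<bar>" for s
      proof (cases "s \<in> pos_orthant")
        case True
        then show ?thesis
          using p(2)[OF e_cube[OF True]]
          by (simp only: abs_mult mult.commute[of "\<bar>h s\<bar>"]) (intro mult_right_mono, auto)
      qed (simp add: supp)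
      have int: "integrable lborel (\<lambda>s. h s * (\<phi> (e s) - p (e s)))"
        by (rule Bochner_Integration.integrable_bound[where f="\<lambda>s. \<epsilon> * \<bar>h s\<bar>"])
           (use h le in \<open>auto simp: abs_of_pos[OF \<open>\<epsilon> > 0\<close>] abs_mult\<close>)
      have "(\<integral>s. h s * \<phi> (e s) \<partial>lborel)
          = (\<integral>s. h s * (\<phi> (e s) - p (e s)) + h s * p (e s) \<partial>lborel)"
        by (simp add: algebra_simps)
      also have "\<dots> = (\<integral>s. h s * (\<phi> (e s) - p (e s)) \<partial>lborel)"
        using int poly[OF p(1)] by (subst Bochner_Integration.integral_add) auto
      also have "\<bar>\<dots>\<bar> \<le> (\<integral>s. \<bar>h s * (\<phi> (e s) - p (e s))\<bar> \<partial>lborel)"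
        by (rule integral_abs_bound)
      also have "\<dots> \<le> (\<integral>s. \<epsilon> * \<bar>h s\<bar> \<partial>lborel)"
        by (rule integral_mono) (use int h le in auto)
      finally show ?thesis by simp
    qed
    have "((\<lambda>\<epsilon>. \<epsilon> * (\<integral>s. \<bar>h s\<bar> \<partial>lborel)) \<longlongrightarrow> 0 * (\<integral>s. \<bar>h s\<bar> \<partial>lborel)) (at_right 0)"
      by (intro tendsto_intros)
    then have "\<bar>\<integral>s. h s * \<phi> (e s) \<partial>lborel\<bar> \<le> 0 * (\<integral>s. \<bar>h s\<bar> \<partial>lborel)"
      by (rule tendsto_lowerbound) (use bound in \<open>auto simp: eventually_at_right_less eventually_at_filter\<close>)
    then show ?thesis by simp
  qed
  have closed: "(\<integral>s. h s * indicator C (e s) \<partial>lborel) = 0" if C: "closed C" for C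
  proof (cases "C = {}")
    case False
    \<comment> \<open>Continuous approximations of the indicator of \<open>C\<close>: 1 on
      \<open>C\<close> and, for positive \<open>n\<close>, 0 at distance at least
      \<open>1 / n\<close>. The empty set is a separate case because \<open>infdist y {}\<close> is
      0, which would make \<open>\<phi> n\<close> constantly 1.\<close>
    define \<phi> :: "nat \<Rightarrow> real ^ 'n \<Rightarrow> real" where "\<phi> n y = max 0 (1 - real n * infdist y C)" for n y
    have \<phi>_cont: "continuous_on UNIV (\<phi> n)" for n
      unfolding \<phi>_def by (intro continuous_intros)
    have [measurable]: "\<phi> n \<in> borel_measurable borel" for n
      using \<phi>_cont by (rule borel_measurable_continuous_onI)
    have [measurable]: "C \<in> sets borel"
      using C by (rule borel_closed)
    have lim: "(\<lambda>n. \<phi> n y) \<longlonglongrightarrow> indicator C y" for y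
    proof (cases "y \<in> C")
      case True
      then show ?thesis by (simp add: \<phi>_def)
    next
      case no: False
      then have pos: "infdist y C > 0"
        using in_closed_iff_infdist_zero[OF C False] infdist_nonneg[of y C] by (auto simp: less_le)
      have "eventually (\<lambda>n. real n * infdist y C \<ge> 1) sequentially"
        using eventually_ge_at_top[of "nat \<lceil>1 / infdist y C\<rceil>"]
        by eventually_elim (use pos in \<open>auto simp: field_simps nat_le_iff ceiling_le_iff\<close>)
      then have "eventually (\<lambda>n. \<phi> n y = 0) sequentially"
        by eventually_elim (auto simp: \<phi>_def)
      then show ?thesis using no by (simp add: tendsto_eventually)
    qed
    have "(\<lambda>n. \<integral>s. h s * \<phi> n (e s) \<partial>lborel) \<longlonglongrightarrow> (\<integral>s. h s * indicator C (e s) \<partial>lborel)"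
    proof (rule integral_dominated_convergence[where w="\<lambda>s. \<bar>h s\<bar>"])
      show "AE s in lborel. (\<lambda>n. h s * \<phi> n (e s)) \<longlonglongrightarrow> h s * indicator C (e s)"
        using lim by (intro AE_I2 tendsto_mult tendsto_const)
      have "\<bar>\<phi> n y\<bar> \<le> 1" for n y
        by (auto simp: \<phi>_def infdist_nonneg)
      then show "AE s in lborel. norm (h s * \<phi> n (e s)) \<le> \<bar>h s\<bar>" for n
        by (intro AE_I2) (auto simp: abs_mult intro: mult_left_le)
    qed (use h in auto)
    then show ?thesis
      by (simp add: cont[OF \<phi>_cont] LIMSEQ_const_iff)
  qed simp
  \<comment> \<open>\<open>l\<close> is a Borel left inverse of \<open>e\<close>, so every Borel set
    \<open>A\<close> is the preimage under \<open>e\<close> of a Borel set, and vanishing transfers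
    from the cube back to the variable \<open>s\<close>. The logarithm matters only at the positive
    coordinates of \<open>e s\<close>.\<close>
  define l :: "real ^ 'n \<Rightarrow> real ^ 'n" where "l y = (\<chi> i. - ln (y $ i))" for y
  have [measurable]: "l \<in> borel_measurable borel"
    unfolding l_def by (rule borel_measurable_euclidean_space[THEN iffD2]) (auto simp: Basis_vec_def inner_axis)
  have le: "l (e s) = s" for s
    by (simp add: l_def e_def vec_eq_iff)
  have zero: "(\<integral>s. h s * indicator A s \<partial>lborel) = 0" if [measurable]: "A \<in> sets borel" for A
  proof -
    have "(\<integral>s. h s * indicator (l -` A \<inter> space borel) (e s) \<partial>lborel) = 0"
    proof (rule integral_indicator_zero_sigma[OF h _ closed])
      show "l -` A \<inter> space borel \<in> sets borel"
        by (rule measurable_sets[of l borel borel]) auto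
    qed auto
    then show ?thesis by (simp add: indicator_def le)
  qed
  have int: "integrable lborel (\<lambda>s. h s * indicator A s)" if [measurable]: "A \<in> sets borel" for A
    by (rule Bochner_Integration.integrable_bound[OF h]) (auto simp: indicator_def)
  \<comment> \<open>Splitting by the sign of \<open>h\<close> writes its L1 norm as a difference of
    two integrals over Borel sets, both zero.\<close>
  have "(\<integral>s. \<bar>h s\<bar> \<partial>lborel) = (\<integral>s. h s * indicator {s. h s > 0} s - h s * indicator {s. h s < 0} s \<partial>lborel)"
    by (rule Bochner_Integration.integral_cong) (auto simp: indicator_def)
  also have "\<dots> = 0"
    by (subst Bochner_Integration.integral_diff) (auto simp: zero int)
  finally have "AE s in lborel. \<bar>h s\<bar> = 0"
    using h by (subst (asm) integral_nonneg_eq_0_iff_AE) auto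
  then show ?thesis by simp
qed

text \<open>The weight at \<open>1\<close> makes the difference of the representatives integrable,
  and its exponential moment with exponents \<open>k\<close> is the difference of the transforms at
  the point \<open>1 + k\<close> of the orthant.\<close>

lemma laplace_transform_inj:
  fixes f f' :: "real ^ 'n \<Rightarrow> real"
  assumes "f \<in> laplace_transformable" "f' \<in> laplace_transformable"
    and eq: "\<And>x. x \<in> pos_orthant \<Longrightarrow> laplace_transform f x = laplace_transform f' x"
  shows "ae_eq f f'"
proof -
  obtain g where g: "borel_rep f g" using assms(1) by (rule borel_rep_exists)
  obtain g' where g': "borel_rep f' g'" using assms(2) by (rule borel_rep_exists)
  have "AE s in lborel. (g s - g' s) * exp (- (s \<bullet> 1)) = 0"
  proof (rule exp_moments_zero_imp_AE_zero)
    show "integrable lborel (\<lambda>s. (g s - g' s) * exp (- (s \<bullet> 1)))"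
      using borel_repD(4)[OF g one_in_pos_orthant] borel_repD(4)[OF g' one_in_pos_orthant]
      by (simp add: left_diff_distrib)
    show "(g s - g' s) * exp (- (s \<bullet> 1)) = 0" if "s \<notin> pos_orthant" for s
      using that by (simp add: borel_repD(2)[OF g] borel_repD(2)[OF g'])
    fix k :: "'n \<Rightarrow> nat"
    define x :: "real ^ 'n" where "x = 1 + (\<chi> i. real (k i))"
    have x: "x \<in> pos_orthant"
      by (auto simp: x_def pos_orthant_def add_pos_nonneg)
    have "exp (- (s \<bullet> 1)) * (\<Prod>i\<in>UNIV. exp (- (s $ i)) ^ k i) = exp (- (s \<bullet> x))" for s
    proof -
      have "(\<Prod>i\<in>UNIV. exp (- (s $ i)) ^ k i) = exp (\<Sum>i\<in>UNIV. - (s $ i * real (k i)))"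
        by (simp add: exp_sum exp_of_nat_mult[symmetric] mult.commute)
      then show ?thesis
        by (simp add: x_def inner_add_right inner_vec_def[of s "\<chi> i. real (k i)"] sum_negf flip: exp_add)
    qed
    then have "(\<integral>s. (g s - g' s) * exp (- (s \<bullet> 1)) * (\<Prod>i\<in>UNIV. exp (- (s $ i)) ^ k i) \<partial>lborel)
        = (\<integral>s. g s * exp (- (s \<bullet> x)) - g' s * exp (- (s \<bullet> x)) \<partial>lborel)"
      by (simp add: mult.assoc left_diff_distrib)
    also have "\<dots> = 0"
      using eq[OF x] borel_repD(4)[OF g x] borel_repD(4)[OF g' x]
      by (simp add: borel_rep_laplace(2)[OF g] borel_rep_laplace(2)[OF g'])
    finally show "(\<integral>s. (g s - g' s) * exp (- (s \<bullet> 1)) * (\<Prod>i\<in>UNIV. exp (- (s $ i)) ^ k i) \<partial>lborel) = 0" .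
  qed
  then have "AE s in lborel. g s = g' s" by simp
  with g g' show ?thesis by (rule borel_rep_ae_eq)
qed

section \<open>The Riemann--Liouville kernel\<close>

text \<open>Euler's integral for Gamma after the substitution of \<open>x * t\<close> for
  \<open>t\<close>. The version for nonnegative integrals gives finiteness together with the
  value.\<close>

lemma nn_integral_Gamma_scaled:
  fixes a x :: real
  assumes "a > 0" "x > 0"
  shows "(\<integral>\<^sup>+t. ennreal (indicator {0<..} t * (t powr (a - 1) / Gamma a * exp (- (t * x)))) \<partial>lborel)
    = ennreal (x powr - a)"
proof -
  have G: "Gamma a > 0" using assms(1) by (rule Gamma_real_pos)
  let ?f = "\<lambda>t::real. indicator {0..} t * t powr (a - 1) / exp t"
  have "ennreal (Gamma a) = (\<integral>\<^sup>+t. ennreal (?f t) \<partial>lborel)"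
    using Gamma_conv_nn_integral_real[OF assms(1)] by simp
  also have "\<dots> = ennreal x * (\<integral>\<^sup>+t. ennreal (?f (0 + x * t)) \<partial>lborel)"
    using assms by (subst nn_integral_real_affine[where c=x and t=0]) auto
  also have "\<dots> = (\<integral>\<^sup>+t. ennreal x * ennreal (?f (0 + x * t)) \<partial>lborel)"
    by (simp add: nn_integral_cmult)
  finally have *: "ennreal (Gamma a) = (\<integral>\<^sup>+t. ennreal x * ennreal (?f (0 + x * t)) \<partial>lborel)" .
  have "(\<integral>\<^sup>+t. ennreal (indicator {0<..} t * (t powr (a - 1) / Gamma a * exp (- (t * x)))) \<partial>lborel)
      = (\<integral>\<^sup>+t. ennreal (x powr - a / Gamma a) * (ennreal x * ennreal (?f (0 + x * t))) \<partial>lborel)"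
  proof (rule nn_integral_cong)
    fix t :: real
    have "indicator {0<..} t * (t powr (a - 1) / Gamma a * exp (- (t * x)))
        = (x powr - a / Gamma a) * (x * ?f (0 + x * t))"
    proof (cases "t > 0")
      case True
      have "x * x powr (a - 1) * x powr - a = 1"
        using assms by (simp add: powr_diff powr_minus field_simps)
      with True assms G show ?thesis
        by (simp add: powr_mult exp_minus field_simps)
    next
      case False
      then show ?thesis
        using assms by (cases "t = 0") (auto simp: zero_le_mult_iff)
    qed
    then show "ennreal (indicator {0<..} t * (t powr (a - 1) / Gamma a * exp (- (t * x))))
        = ennreal (x powr - a / Gamma a) * (ennreal x * ennreal (?f (0 + x * t)))"
      using assms G by (simp add: ennreal_mult[symmetric])
  qed
  also have "\<dots> = ennreal (x powr - a / Gamma a) * ennreal (Gamma a)"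
    unfolding * by (rule nn_integral_cmult) auto
  also have "\<dots> = ennreal (x powr - a)"
    using G by (simp add: ennreal_mult[symmetric])
  finally show ?thesis .
qed

lemma Basis_vec_real_eq: "(Basis :: (real ^ 'n) set) = (\<lambda>i. axis i 1) ` UNIV"
  by (auto simp: Basis_vec_def)

lemma nn_integral_lborel_vec_prod:
  fixes f :: "'n::finite \<Rightarrow> real \<Rightarrow> real"
  assumes "\<And>i. f i \<in> borel_measurable borel" and "\<And>i t. 0 \<le> f i t"
  shows "(\<integral>\<^sup>+s. ennreal (\<Prod>i\<in>UNIV. f i (s $ i)) \<partial>(lborel :: (real ^ 'n) measure))
    = (\<Prod>i\<in>UNIV. \<integral>\<^sup>+t. ennreal (f i t) \<partial>lborel)"
proof -
  \<comment> \<open>\<open>ix\<close> reads the index \<open>i\<close> off the basis vector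
    \<open>axis i 1\<close>, which turns the product over \<open>Basis\<close> into one over
    coordinates.\<close>
  define ix :: "real ^ 'n \<Rightarrow> 'n" where "ix b = (THE i. b = axis i 1)" for b
  have ix: "ix (axis i 1) = i" for i
    by (simp add: ix_def axis_eq_axis)
  have reindex: "(\<Prod>b\<in>Basis. F b) = (\<Prod>i\<in>UNIV. F (axis i 1))" for F :: "real ^ 'n \<Rightarrow> ennreal"
    unfolding Basis_vec_real_eq by (subst prod.reindex) (auto simp: inj_on_def axis_eq_axis)
  have "(\<integral>\<^sup>+s. (\<Prod>b\<in>Basis. ennreal (f (ix b) (s \<bullet> b))) \<partial>(lborel :: (real ^ 'n) measure))
      = (\<Prod>b\<in>(Basis :: (real ^ 'n) set). \<integral>\<^sup>+t. ennreal (f (ix b) t) \<partial>lborel)"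
    using assms by (intro nn_integral_lborel_prod) auto
  then show ?thesis
    using assms(2) by (simp add: reindex ix inner_axis prod_ennreal)
qed

text \<open>On the orthant the integrand is nonnegative and factors over the coordinates, so
  Tonelli's theorem reduces it to scaled Gamma integrals; finiteness of the result gives
  transformability.\<close>

lemma laplace_RL_kernel:
  fixes \<alpha> :: "real ^ 'n"
  assumes \<alpha>: "\<alpha> \<in> pos_orthant"
  shows "RL_kernel \<alpha> \<in> laplace_transformable"
    and "x \<in> pos_orthant \<Longrightarrow> laplace_transform (RL_kernel \<alpha>) x = (\<Prod>i\<in>UNIV. x $ i powr - (\<alpha> $ i))"
proof -
  define g where "g s = indicator pos_orthant s * RL_kernel \<alpha> s" for s
  have [measurable]: "g \<in> borel_measurable borel"
    unfolding g_def RL_kernel_def by measurable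
  have bi: "has_bochner_integral lborel (\<lambda>s. g s * exp (- (s \<bullet> x))) (\<Prod>i\<in>UNIV. x $ i powr - (\<alpha> $ i))"
    if x: "x \<in> pos_orthant" for x
  proof (rule has_bochner_integral_nn_integral)
    define f where "f i t = indicator {0<..} t * (t powr (\<alpha> $ i - 1) / Gamma (\<alpha> $ i) * exp (- (t * x $ i)))"
      for i and t :: real
    have f_meas: "f i \<in> borel_measurable borel" for i
      unfolding f_def by measurable
    have G: "Gamma (\<alpha> $ i) > 0" for i
      using \<alpha> by (auto simp: pos_orthant_def intro: Gamma_real_pos)
    have f_nonneg: "0 \<le> f i t" for i t
      using G[of i] by (auto simp: f_def indicator_def)
    have g_eq: "g s * exp (- (s \<bullet> x)) = (\<Prod>i\<in>UNIV. f i (s $ i))" for s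
    proof (cases "s \<in> pos_orthant")
      case True
      then show ?thesis
        by (simp add: g_def RL_kernel_def f_def inner_vec_def exp_sum flip: sum_negf prod.distrib)
          (simp add: pos_orthant_def)
    next
      case False
      then obtain i where "s $ i \<le> 0" by (auto simp: pos_orthant_def not_less)
      then have "(\<Prod>i\<in>UNIV. f i (s $ i)) = 0"
        by (intro prod_zero) (auto simp: f_def intro!: exI[of _ i])
      with False show ?thesis by (simp add: g_def)
    qed
    show "AE s in lborel. 0 \<le> g s * exp (- (s \<bullet> x))"
      unfolding g_eq by (intro AE_I2 prod_nonneg ballI f_nonneg)
    have "(\<integral>\<^sup>+s. ennreal (g s * exp (- (s \<bullet> x))) \<partial>lborel)
        = (\<Prod>i\<in>UNIV. \<integral>\<^sup>+t. ennreal (f i t) \<partial>lborel)"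
      unfolding g_eq by (rule nn_integral_lborel_vec_prod[OF f_meas f_nonneg])
    also have "\<dots> = (\<Prod>i\<in>UNIV. ennreal (x $ i powr - (\<alpha> $ i)))"
      unfolding f_def using \<alpha> x by (intro prod.cong refl nn_integral_Gamma_scaled) (auto simp: pos_orthant_def)
    finally show "(\<integral>\<^sup>+s. ennreal (g s * exp (- (s \<bullet> x))) \<partial>lborel)
        = ennreal (\<Prod>i\<in>UNIV. x $ i powr - (\<alpha> $ i))"
      by (simp add: prod_ennreal)
  qed (auto intro: prod_nonneg)
  have "borel_rep (RL_kernel \<alpha>) g"
    using bi by (auto simp: borel_rep_def g_def[abs_def] has_bochner_integral_iff RL_kernel_def)
  from borel_rep_laplace[OF this] bi
  show "RL_kernel \<alpha> \<in> laplace_transformable"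
    and "x \<in> pos_orthant \<Longrightarrow> laplace_transform (RL_kernel \<alpha>) x = (\<Prod>i\<in>UNIV. x $ i powr - (\<alpha> $ i))"
    by (auto simp: has_bochner_integral_iff)
qed

lemma laplace_RL_kernel_pos:
  assumes "\<alpha> \<in> pos_orthant" "x \<in> pos_orthant"
  shows "laplace_transform (RL_kernel \<alpha>) x > 0"
proof -
  have "x $ i \<noteq> 0" for i
    using assms(2) by (simp add: pos_orthant_def less_imp_neq[THEN not_sym])
  with assms show ?thesis by (auto simp: laplace_RL_kernel intro!: prod_pos)
qed

section \<open>Additive and multiplicative functions on the orthant\<close>

text \<open>
  Subtracting an integer combination of the spanning set moves \<open>N *\<^sub>R v\<close> into a fixed ball without
  changing the value of \<open>X\<close>, so \<open>X v = O(1 / N)\<close>.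
\<close>

lemma additive_bounded_zero_on_span:
  fixes X :: "'a::real_normed_vector \<Rightarrow> real"
  assumes add: "\<And>u v. X (u + v) = X u + X v"
    and B: "finite B" "\<And>b. b \<in> B \<Longrightarrow> X b = 0"
    and bound: "\<delta> > 0" "\<And>v. norm v < \<delta> \<Longrightarrow> \<bar>X v\<bar> \<le> C"
    and v: "v \<in> span B"
  shows "X v = 0"
proof -
  interpret additive X by unfold_locales (rule add)
  have scale: "X (real n *\<^sub>R u) = real n * X u" for n u
    by (induction n) (simp_all add: zero scaleR_left_distrib add distrib_right)
  have scale_int: "X (real_of_int n *\<^sub>R u) = real_of_int n * X u" for n u
  proof -
    obtain p q where "n = int p - int q" by (rule int_diff_cases)
    then show ?thesis by (simp add: scaleR_left_diff_distrib diff scale left_diff_distrib)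
  qed
  \<comment> \<open>\<open>R\<close> bounds every combination of \<open>B\<close> with coefficients
    in \<open>[0, 1)\<close>. \<open>M\<close> is chosen so that such a combination, divided by
    \<open>M\<close>, has norm below \<delta>.\<close>
  define R where "R = (\<Sum>b\<in>B. norm b)"
  obtain M :: nat where M: "R < real M * \<delta>"
    using reals_Archimedean3[OF bound(1)] by blast
  have R: "R \<ge> 0" by (auto simp: R_def intro: sum_nonneg)
  have M0: "M > 0" using M R by (cases M) auto
  have ball: "\<bar>X r\<bar> \<le> real M * C" if "norm r \<le> R" for r
  proof -
    have "norm ((1 / real M) *\<^sub>R r) < \<delta>"
      using that M M0 by (simp add: field_simps)
    then have "\<bar>X ((1 / real M) *\<^sub>R r)\<bar> \<le> C" by (rule bound)
    moreover have "X r = real M * X ((1 / real M) *\<^sub>R r)"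
      using M0 by (simp flip: scale)
    ultimately show ?thesis using M0 by (simp add: abs_mult)
  qed
  have "real n * \<bar>X v\<bar> \<le> real M * C" for n
  proof -
    obtain c where c: "v = (\<Sum>b\<in>B. c b *\<^sub>R b)"
      using v span_finite[OF B(1)] by auto
    \<comment> \<open>The integer parts of the coefficients of \<open>n *\<^sub>R v\<close>
      contribute nothing to \<open>X\<close>; the fractional parts leave a remainder of norm at most
      \<open>R\<close>. The resulting bound does not depend on \<open>n\<close>.\<close>
    define r where "r = (\<Sum>b\<in>B. frac (real n * c b) *\<^sub>R b)"
    have "real n *\<^sub>R v = (\<Sum>b\<in>B. real_of_int \<lfloor>real n * c b\<rfloor> *\<^sub>R b) + r"
      by (simp add: c r_def scaleR_sum_right frac_def flip: sum.distrib scaleR_left_distrib)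
    then have "real n * X v = X r"
      using B(2) by (simp add: add sum scale_int flip: scale)
    moreover have "norm r \<le> R"
      unfolding r_def R_def
    proof (rule sum_norm_le)
      show "norm (frac (real n * c b) *\<^sub>R b) \<le> norm b" for b
        using frac_ge_0[of "real n * c b"] frac_lt_1[of "real n * c b"]
        by (simp add: mult_left_le_one_le)
    qed
    ultimately show ?thesis using ball[of r] by (simp add: abs_mult[of "real n", simplified])
  qed
  then show ?thesis
    using reals_Archimedean3[of "\<bar>X v\<bar>"] by (metis abs_le_zero_iff linorder_not_less)
qed

text \<open>Hence every vector is a difference of two vectors of the orthant, which is what extends
  functions from the orthant to the whole space.\<close>

lemma pos_orthant_translate:
  fixes v :: "real ^ 'n"
  obtains c where "c > 0" "v + c *\<^sub>R 1 \<in> pos_orthant"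
proof
  show "norm v + 1 > 0" using norm_ge_zero[of v] by linarith
  show "v + (norm v + 1) *\<^sub>R 1 \<in> pos_orthant"
    unfolding pos_orthant_def
  proof (intro CollectI allI)
    fix i
    have "\<bar>v $ i\<bar> \<le> norm v" by (rule component_le_norm_cart)
    then show "0 < (v + (norm v + 1) *\<^sub>R 1) $ i" by simp
  qed
qed

text \<open>The extension sends a difference \<open>p - q\<close> of orthant vectors to
  \<open>\<psi> p - \<psi> q\<close>. Continuity at one point, translated to the origin by
  additivity, provides the boundedness that forces the extension to vanish on the span of
  \<open>B\<close>.\<close>

lemma additive_orthant_zero:
  fixes \<psi> :: "real ^ 'n \<Rightarrow> real"
  assumes add: "\<And>u v. u \<in> pos_orthant \<Longrightarrow> v \<in> pos_orthant \<Longrightarrow> \<psi> (u + v) = \<psi> u + \<psi> v"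
    and B: "finite B" "B \<subseteq> pos_orthant" "\<And>b. b \<in> B \<Longrightarrow> \<psi> b = 0" "span B = UNIV"
    and cont: "\<alpha>\<^sub>0 \<in> pos_orthant" "continuous (at \<alpha>\<^sub>0 within pos_orthant) \<psi>"
    and \<alpha>: "\<alpha> \<in> pos_orthant"
  shows "\<psi> \<alpha> = 0"
proof -
  define c where "c v = (SOME c. c > 0 \<and> v + c *\<^sub>R 1 \<in> pos_orthant)" for v :: "real ^ 'n"
  have c: "c v > 0" "v + c v *\<^sub>R 1 \<in> pos_orthant" for v
    using someI_ex[of "\<lambda>c. c > 0 \<and> v + c *\<^sub>R 1 \<in> pos_orthant"] pos_orthant_translate[of v]
    unfolding c_def by blast+
  define X where "X v = \<psi> (v + c v *\<^sub>R 1) - \<psi> (c v *\<^sub>R 1)" for v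
  have c1: "c v *\<^sub>R 1 \<in> pos_orthant" for v :: "real ^ 'n"
    using c(1) one_in_pos_orthant by (rule pos_orthant_scaleR)
  \<comment> \<open>The value is independent of the chosen shift: both representations of
    \<open>p - q\<close> have the common sum \<open>p + c (p - q) *\<^sub>R 1\<close>, to which
    additivity is applied twice.\<close>
  have X_eq: "X (p - q) = \<psi> p - \<psi> q" if "p \<in> pos_orthant" "q \<in> pos_orthant" for p q
  proof -
    let ?c = "c (p - q) *\<^sub>R 1"
    have "\<psi> ((p - q + ?c) + q) = \<psi> (p - q + ?c) + \<psi> q"
      using c that by (intro add)
    moreover have "\<psi> (p + ?c) = \<psi> p + \<psi> ?c"
      using c1 that by (intro add)
    ultimately show ?thesis by (simp add: X_def algebra_simps)
  qed
  have X_pos: "X p = \<psi> p" if "p \<in> pos_orthant" for p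
    using X_eq[OF pos_orthant_add[OF that that] that] add[OF that that] by simp
  have X_add: "X (u + v) = X u + X v" for u v
  proof -
    have "X (u + v) = X ((u + c u *\<^sub>R 1 + (v + c v *\<^sub>R 1)) - (c u *\<^sub>R 1 + c v *\<^sub>R 1))"
      by (simp add: algebra_simps)
    also have "\<dots> = X u + X v"
      using c c1 by (subst X_eq) (auto simp: add X_def intro: pos_orthant_add)
    finally show ?thesis .
  qed
  obtain \<delta>\<^sub>1 where \<delta>\<^sub>1: "\<delta>\<^sub>1 > 0" "\<And>\<beta>. \<beta> \<in> pos_orthant \<Longrightarrow> dist \<beta> \<alpha>\<^sub>0 < \<delta>\<^sub>1 \<Longrightarrow> \<bar>\<psi> \<beta> - \<psi> \<alpha>\<^sub>0\<bar> < 1"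
    using cont(2) unfolding continuous_within_eps_delta dist_real_def
    by (meson zero_less_one)
  obtain \<delta>\<^sub>2 where \<delta>\<^sub>2: "\<delta>\<^sub>2 > 0" "ball \<alpha>\<^sub>0 \<delta>\<^sub>2 \<subseteq> pos_orthant"
    using open_pos_orthant cont(1) unfolding open_contains_ball by blast
  \<comment> \<open>Here \<open>X v\<close> is the increment of \<psi> from
    \<open>\<alpha>\<^sub>0\<close> to \<open>\<alpha>\<^sub>0 + v\<close>; the second radius keeps
    \<open>\<alpha>\<^sub>0 + v\<close> in the orthant and the first keeps the increment below
    1.\<close>
  have bound: "\<bar>X v\<bar> \<le> 1" if "norm v < min \<delta>\<^sub>1 \<delta>\<^sub>2" for v
  proof -
    have v: "\<alpha>\<^sub>0 + v \<in> pos_orthant"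
      using that \<delta>\<^sub>2(2) by (auto simp: subset_iff dist_norm)
    with that \<delta>\<^sub>1(2)[OF v] X_eq[OF v cont(1)] show ?thesis
      by (simp add: dist_norm)
  qed
  have "X \<alpha> = 0"
    by (rule additive_bounded_zero_on_span[where B=B and \<delta>="min \<delta>\<^sub>1 \<delta>\<^sub>2" and C=1])
       (use B \<delta>\<^sub>1(1) \<delta>\<^sub>2(1) X_add X_pos bound in auto)
  with X_pos[OF \<alpha>] show ?thesis by simp
qed

lemma multiplicative_orthant_unique:
  fixes \<phi> \<rho> :: "real ^ 'n \<Rightarrow> real"
  assumes \<phi>_mult: "\<And>u v. u \<in> pos_orthant \<Longrightarrow> v \<in> pos_orthant \<Longrightarrow> \<phi> (u + v) = \<phi> u * \<phi> v"
    and \<rho>_mult: "\<And>u v. u \<in> pos_orthant \<Longrightarrow> v \<in> pos_orthant \<Longrightarrow> \<rho> (u + v) = \<rho> u * \<rho> v"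
    and \<rho>_pos: "\<And>u. u \<in> pos_orthant \<Longrightarrow> \<rho> u > 0"
    and \<rho>_cont: "continuous_on pos_orthant \<rho>"
    and B: "finite B" "B \<subseteq> pos_orthant" "\<And>b. b \<in> B \<Longrightarrow> \<phi> b = \<rho> b" "span B = UNIV"
    and cont: "\<alpha>\<^sub>0 \<in> pos_orthant" "continuous (at \<alpha>\<^sub>0 within pos_orthant) \<phi>"
    and \<alpha>: "\<alpha> \<in> pos_orthant"
  shows "\<phi> \<alpha> = \<rho> \<alpha>"
proof -
  obtain b where b: "b \<in> B"
  proof (cases "B = {}")
    case True
    with B(4) have "(UNIV :: (real ^ 'n) set) = {0}" by simp
    then have "(1 :: real ^ 'n) = 0" by blast
    then show ?thesis by simp
  qed blast
  have b_pos: "b \<in> pos_orthant" "\<phi> b > 0"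
    using b B \<rho>_pos by auto
  have nz: "\<phi> u \<noteq> 0" if u: "u \<in> pos_orthant" for u
  proof
    assume zero: "\<phi> u = 0"
    \<comment> \<open>Counting starts at \<open>Suc n\<close> because the zero multiple of
      \<open>b\<close> lies outside the orthant.\<close>
    have multiple: "\<phi> (real (Suc n) *\<^sub>R b) > 0" for n
    proof (induction n)
      case (Suc n)
      have "\<phi> (b + real (Suc n) *\<^sub>R b) = \<phi> b * \<phi> (real (Suc n) *\<^sub>R b)"
        using b_pos by (intro \<phi>_mult pos_orthant_scaleR) auto
      also have "b + real (Suc n) *\<^sub>R b = real (Suc (Suc n)) *\<^sub>R b"
        by (simp only: of_nat_Suc[of "Suc n"] scaleR_left_distrib scaleR_one)
      finally show ?case using Suc b_pos by simp
    qed (use b_pos in simp)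
    \<comment> \<open>A zero at \<open>u\<close> would propagate to all of \<open>u\<close> plus the
      orthant. The sum of the ceilings dominates every ratio at once, and the successor makes the
      inequality strict, so a multiple of \<open>b\<close> lies in that set, where \<phi> is
      positive.\<close>
    define N where "N = (\<Sum>i\<in>UNIV. nat \<lceil>u $ i / b $ i\<rceil>)"
    have "u $ i < real (Suc N) * b $ i" for i
    proof -
      have "nat \<lceil>u $ i / b $ i\<rceil> \<le> N"
        unfolding N_def by (rule member_le_sum) auto
      then have "u $ i / b $ i < real (Suc N)" by linarith
      moreover have "b $ i > 0" using b_pos by (simp add: pos_orthant_def)
      ultimately show ?thesis by (simp add: field_simps)
    qed
    then have "real (Suc N) *\<^sub>R b - u \<in> pos_orthant"
      by (simp add: pos_orthant_def)
    from \<phi>_mult[OF u this] multiple[of N] zero show False by simp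
  qed
  have pos: "\<phi> u > 0" if u: "u \<in> pos_orthant" for u
  proof -
    have half: "(1/2) *\<^sub>R u \<in> pos_orthant" using u by (intro pos_orthant_scaleR) auto
    have "\<phi> u = \<phi> ((1/2) *\<^sub>R u) * \<phi> ((1/2) *\<^sub>R u)"
      using \<phi>_mult[OF half half] by (simp flip: scaleR_left_distrib)
    also have "\<dots> > 0" using nz[OF half] by (auto simp: zero_less_mult_iff)
    finally show ?thesis .
  qed
  have "ln (\<phi> \<alpha>) - ln (\<rho> \<alpha>) = 0"
  proof (rule additive_orthant_zero[where B=B and \<alpha>\<^sub>0=\<alpha>\<^sub>0])
    show "ln (\<phi> (u + v)) - ln (\<rho> (u + v)) = (ln (\<phi> u) - ln (\<rho> u)) + (ln (\<phi> v) - ln (\<rho> v))"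
      if "u \<in> pos_orthant" "v \<in> pos_orthant" for u v
      using that pos \<rho>_pos by (simp add: \<phi>_mult \<rho>_mult ln_mult_pos)
    have "continuous (at \<alpha>\<^sub>0 within pos_orthant) \<rho>"
      using \<rho>_cont cont(1) by (simp add: continuous_on_eq_continuous_within)
    with cont show "continuous (at \<alpha>\<^sub>0 within pos_orthant) (\<lambda>\<alpha>. ln (\<phi> \<alpha>) - ln (\<rho> \<alpha>))"
      using pos[OF cont(1)] \<rho>_pos[OF cont(1)]
      unfolding continuous_within by (intro tendsto_diff tendsto_ln) auto
  qed (use B cont \<alpha> in auto)
  with pos[OF \<alpha>] \<rho>_pos[OF \<alpha>] show ?thesis by simp
qed

section \<open>Characterization of the Riemann--Liouville integral\<close>

theorem theorem5p2:
  fixes K :: "real ^ 'n \<Rightarrow> real ^ 'n \<Rightarrow> real"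
    and a :: "'n \<Rightarrow> real ^ 'n"
  assumes n: "CARD('n) > 1"
    and transformable: "\<forall>\<alpha>\<in>pos_orthant. K \<alpha> \<in> laplace_transformable"
  shows
    "((\<forall>x\<in>pos_orthant. \<exists>\<alpha>\<^sub>0\<in>pos_orthant.
          continuous (at \<alpha>\<^sub>0 within pos_orthant) (\<lambda>\<alpha>. laplace_transform (K \<alpha>) x)) \<longleftrightarrow>
      (\<forall>f\<in>laplace_transformable. \<forall>x\<in>pos_orthant. \<exists>\<alpha>\<^sub>0\<in>pos_orthant.
          continuous (at \<alpha>\<^sub>0 within pos_orthant) (\<lambda>\<alpha>. laplace_transform (conv_op K \<alpha> f) x))) \<and>
     ((\<forall>j. a j \<in> pos_orthant) \<and> inj a \<and> independent (range a) \<and>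
      (\<forall>j. ae_eq (K (a j)) (RL_kernel (a j))) \<and>
      (\<forall>\<alpha>\<in>pos_orthant. \<forall>\<beta>\<in>pos_orthant. \<forall>f\<in>laplace_transformable.
          ae_eq (conv_op K (\<alpha> + \<beta>) f) (conv_op K \<alpha> (conv_op K \<beta> f))) \<and>
      (\<forall>x\<in>pos_orthant. \<exists>\<alpha>\<^sub>0\<in>pos_orthant.
          continuous (at \<alpha>\<^sub>0 within pos_orthant) (\<lambda>\<alpha>. laplace_transform (K \<alpha>) x)) \<longrightarrow>
      (\<forall>\<alpha>\<in>pos_orthant. \<forall>f\<in>laplace_transformable.
          ae_eq (conv_op K \<alpha> f) (RL_integral \<alpha> f)))"
    (is "(?cont \<longleftrightarrow> ?cont_op) \<and> (?hyps \<longrightarrow> ?concl)")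
proof (intro conjI impI iffI)
  have laplace_op: "laplace_transform (conv_op K \<alpha> f) x = laplace_transform (K \<alpha>) x * laplace_transform f x"
    if "\<alpha> \<in> pos_orthant" "f \<in> laplace_transformable" "x \<in> pos_orthant" for \<alpha> f x
    unfolding conv_op_def using transformable that by (intro laplace_convolution) auto
  have op_transformable: "conv_op K \<alpha> f \<in> laplace_transformable"
    if "\<alpha> \<in> pos_orthant" "f \<in> laplace_transformable" for \<alpha> f
    unfolding conv_op_def using transformable that by (intro laplace_convolution) auto
  \<comment> \<open>A test function with positive transform: this factor can be cancelled both in
    the converse of the continuity equivalence and in the index law.\<close>
  let ?r = "RL_kernel (1 :: real ^ 'n)"
  have r: "?r \<in> laplace_transformable" "\<And>x. x \<in> pos_orthant \<Longrightarrow> laplace_transform ?r x > 0"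
    using one_in_pos_orthant by (auto intro: laplace_RL_kernel laplace_RL_kernel_pos)
  \<comment> \<open>The product formula is available for \<open>\<alpha>\<close> in the orthant, and
    continuity within the orthant sees only those values.\<close>
  have cont_op_iff: "continuous (at \<alpha>\<^sub>0 within pos_orthant) (\<lambda>\<alpha>. laplace_transform (conv_op K \<alpha> f) x) \<longleftrightarrow>
      continuous (at \<alpha>\<^sub>0 within pos_orthant) (\<lambda>\<alpha>. laplace_transform (K \<alpha>) x * laplace_transform f x)"
    if "\<alpha>\<^sub>0 \<in> pos_orthant" "f \<in> laplace_transformable" "x \<in> pos_orthant" for \<alpha>\<^sub>0 f x
    unfolding continuous_within
  proof (rule filterlim_cong)
    show "nhds (laplace_transform (conv_op K \<alpha>\<^sub>0 f) x)
        = nhds (laplace_transform (K \<alpha>\<^sub>0) x * laplace_transform f x)"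
      by (simp only: laplace_op[OF that])
    show "\<forall>\<^sub>F \<alpha> in at \<alpha>\<^sub>0 within pos_orthant.
        laplace_transform (conv_op K \<alpha> f) x = laplace_transform (K \<alpha>) x * laplace_transform f x"
      unfolding eventually_at_filter using laplace_op[OF _ that(2,3)] by (intro always_eventually) blast
  qed (rule refl)
  {
    assume ?cont
    then show ?cont_op
      by (auto simp: cont_op_iff intro: continuous_mult_right elim!: bexE ballE)
  next
    assume R: ?cont_op
    show ?cont
    proof
      fix x :: "real ^ 'n" assume x: "x \<in> pos_orthant"
      then obtain \<alpha>\<^sub>0 where \<alpha>\<^sub>0: "\<alpha>\<^sub>0 \<in> pos_orthant"
        and "continuous (at \<alpha>\<^sub>0 within pos_orthant) (\<lambda>\<alpha>. laplace_transform (K \<alpha>) x * laplace_transform ?r x)"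
        using R r(1) cont_op_iff by blast
      from continuous_mult_right[OF this(2), of "inverse (laplace_transform ?r x)"]
      have "continuous (at \<alpha>\<^sub>0 within pos_orthant) (\<lambda>\<alpha>. laplace_transform (K \<alpha>) x)"
        using r(2)[OF x] by (simp add: mult.assoc)
      with \<alpha>\<^sub>0 show "\<exists>\<alpha>\<^sub>0\<in>pos_orthant.
          continuous (at \<alpha>\<^sub>0 within pos_orthant) (\<lambda>\<alpha>. laplace_transform (K \<alpha>) x)" by blast
    qed
  next
    assume hyps: ?hyps
    then have a: "a j \<in> pos_orthant" "ae_eq (K (a j)) (RL_kernel (a j))" for j
      by auto
    \<comment> \<open>Injectivity gives \<open>range a\<close> as many elements as the dimension, so
      independence makes it spanning.\<close>
    have span: "span (range a) = UNIV"
      using hyps card_ge_dim_independent[of "range a" UNIV] by (auto simp: card_image dim_UNIV)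
    have eq: "laplace_transform (K \<alpha>) x = laplace_transform (RL_kernel \<alpha>) x"
      if \<alpha>: "\<alpha> \<in> pos_orthant" and x: "x \<in> pos_orthant" for \<alpha> x
    proof -
      \<comment> \<open>The continuity point may depend on \<open>x\<close>; the uniqueness argument
        is run separately for each fixed \<open>x\<close>.\<close>
      obtain \<alpha>\<^sub>0 where \<alpha>\<^sub>0: "\<alpha>\<^sub>0 \<in> pos_orthant"
        "continuous (at \<alpha>\<^sub>0 within pos_orthant) (\<lambda>\<alpha>. laplace_transform (K \<alpha>) x)"
        using hyps x by blast
      have x_pos: "x $ i > 0" for i using x by (simp add: pos_orthant_def)
      show ?thesis
      proof (rule multiplicative_orthant_unique[where B="range a", OF _ _ _ _ _ _ _ _ \<alpha>\<^sub>0 \<alpha>])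
        fix u v :: "real ^ 'n" assume uv: "u \<in> pos_orthant" "v \<in> pos_orthant"
        \<comment> \<open>The index law applied to \<open>?r\<close>: taking transforms gives the
          multiplicativity multiplied by the transform of \<open>?r\<close>, which is positive and
          cancels.\<close>
        have "laplace_transform (conv_op K (u + v) ?r) x = laplace_transform (conv_op K u (conv_op K v ?r)) x"
          using hyps uv r(1) by (intro laplace_transform_cong op_transformable pos_orthant_add) auto
        then show "laplace_transform (K (u + v)) x = laplace_transform (K u) x * laplace_transform (K v) x"
          using uv x r op_transformable pos_orthant_add[OF uv] r(2)[OF x] by (simp add: laplace_op)
        show "laplace_transform (RL_kernel (u + v)) x
            = laplace_transform (RL_kernel u) x * laplace_transform (RL_kernel v) x"
          using uv x pos_orthant_add[OF uv]
          by (simp add: laplace_RL_kernel powr_add powr_diff powr_minus field_simps flip: prod.distrib)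
      next
        have "continuous_on pos_orthant (\<lambda>\<alpha>. \<Prod>i\<in>UNIV. x $ i powr - (\<alpha> $ i))"
          using x_pos by (intro continuous_intros) (auto simp: less_le)
        then show "continuous_on pos_orthant (\<lambda>\<alpha>. laplace_transform (RL_kernel \<alpha>) x)"
          by (rule continuous_on_eq) (simp add: laplace_RL_kernel x)
      next
        fix b assume "b \<in> range a"
        then show "laplace_transform (K b) x = laplace_transform (RL_kernel b) x"
          using a transformable by (auto intro!: laplace_transform_cong)
      qed (use a x span laplace_RL_kernel_pos in auto)
    qed
    show ?concl
    proof (intro ballI)
      fix \<alpha> :: "real ^ 'n" and f assume \<alpha>: "\<alpha> \<in> pos_orthant" and f: "f \<in> (laplace_transformable :: (real ^ 'n \<Rightarrow> real) set)"
      have "ae_eq (K \<alpha>) (RL_kernel \<alpha>)"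
        using \<alpha> transformable eq by (intro laplace_transform_inj laplace_RL_kernel) auto
      then have "conv_op K \<alpha> f = RL_integral \<alpha> f"
        unfolding conv_op_def RL_integral_def using \<alpha> f transformable by (intro convolution_cong) auto
      then show "ae_eq (conv_op K \<alpha> f) (RL_integral \<alpha> f)"
        by (simp add: ae_eq_def)
    qed
  }
qed

end
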